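(* Let $X:\mathbb{R}^n\to\mathbb{R}^n$ and $Y:\mathbb{R}^m\to\mathbb{R}^m$ be two vector fields, $L:\mathbb{R}^n\to\mathbb{R}^m$ a linear map and $p\in\mathbb{R}^m$ a vector, such that $$L X(x) = Y(Lx+p)\qquad\text{for all } x\in\mathbb{R}^n.$$ Then for any number of stages $s\in\mathbb{N}$, any step size $h$, any vector of weights $b=(b_i)_{i=1}^s$ and any matrix $A=(a_{i,j})_{i,j=1}^s$ giving an explicit Runge-Kutta method (i.e. $a_{i,j}=0$ whenever $i\le j$), we have $$L D_X^{(A,b,h)}(x) + p = D_Y^{(A,b,h)}(Lx+p)\qquad\text{for all } x\in\mathbb{R}^n.$$
   Context: A vector field on $\mathbb{R}^n$ is identified with a map $X:\mathbb{R}^n\to\mathbb{R}^n$. Given $s\in\mathbb{N}$, a real matrix $A=(a_{i,j})_{i,j=1}^s$, real weights $b=(b_i)_{i=1}^s$ and a real step size $h$, the Runge-Kutta method with matrix $A$, weights $b$ and step size $h$ for a vector field $X:\mathbb{R}^n\to\mathbb{R}^n$, denoted $D_X^{(A,b,h)}$, is defined as follows: for $i=1,\dots,s$ set $$k_{X,i}(x) := X\Big(x + h\sum_{j=1}^s a_{i,j}\,k_{X,j}(x)\Big),$$ and then $$D_X^{(A,b,h)}(x) := x + h\sum_{i=1}^s b_i\,k_{X,i}(x).$$ The method is called explicit if $a_{i,j}=0$ whenever $i\le j$; in that case the $k_{X,i}$ are given recursively by $k_{X,1}(x)=X(x)$ and $k_{X,i}(x)=X\big(x+h\sum_{j=1}^{i-1}a_{i,j}k_{X,j}(x)\big)$,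 so that $D_X^{(A,b,h)}:\mathbb{R}^n\to\mathbb{R}^n$ is a well-defined map. $D_Y^{(A,b,h)}:\mathbb{R}^m\to\mathbb{R}^m$ is defined in the same way, with $Y$ and $m$ in place of $X$ and $n$ and with the same $s$, $A$, $b$, $h$. *)

theory Defs
  imports "HOL-Analysis.Analysis"
begin

text \<open>
  Stages are indexed by \<open>{1..s}\<close>; the entries of \<open>A\<close>, \<open>b\<close> and \<open>k\<close> outside this range are junk
  and never used.
\<close>

definition rk_explicit :: "nat \<Rightarrow> (nat \<Rightarrow> nat \<Rightarrow> real) \<Rightarrow> bool" where
  "rk_explicit s A \<longleftrightarrow> (\<forall>i\<in>{1..s}. \<forall>j\<in>{1..s}. i \<le> j \<longrightarrow> A i j = 0)"

definition rk_stages ::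
  "nat \<Rightarrow> (nat \<Rightarrow> nat \<Rightarrow> real) \<Rightarrow> real \<Rightarrow> ('a::real_vector \<Rightarrow> 'a) \<Rightarrow> 'a \<Rightarrow> (nat \<Rightarrow> 'a) \<Rightarrow> bool" where
  "rk_stages s A h X x k \<longleftrightarrow>
     (\<forall>i\<in>{1..s}. k i = X (x + h *\<^sub>R (\<Sum>j=1..s. A i j *\<^sub>R k j)))"

text \<open>
  For general \<open>A\<close> the stage equations are implicit, and the value is unspecified where they do not
  determine it. For explicit methods the value is always determined: see
  \<open>rk_stages_explicit_iff\<close> and \<open>runge_kutta_explicit\<close> below.
\<close>

definition runge_kutta ::
  "nat \<Rightarrow> (nat \<Rightarrow> nat \<Rightarrow> real) \<Rightarrow> (nat \<Rightarrow> real) \<Rightarrow> real \<Rightarrow> ('a::real_vector \<Rightarrow> 'a) \<Rightarrow> 'a \<Rightarrow> 'a" where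
  "runge_kutta s A b h X x =
     (THE y. \<exists>k. rk_stages s A h X x k \<and> y = x + h *\<^sub>R (\<Sum>i=1..s. b i *\<^sub>R k i))"

function rk_stage ::
  "(nat \<Rightarrow> nat \<Rightarrow> real) \<Rightarrow> real \<Rightarrow> ('a::real_vector \<Rightarrow> 'a) \<Rightarrow> 'a \<Rightarrow> nat \<Rightarrow> 'a" where
  "rk_stage A h X x i = X (x + h *\<^sub>R (\<Sum>j=1..<i. A i j *\<^sub>R rk_stage A h X x j))"
  by auto
termination by (relation "Wellfounded.measure (\<lambda>(A, h, X, x, i). i)") auto

declare rk_stage.simps [simp del]

lemma rk_explicit_sum:
  assumes "rk_explicit s A" "i \<in> {1..s}"
  shows "(\<Sum>j=1..s. A i j *\<^sub>R k j) = (\<Sum>j=1..<i. A i j *\<^sub>R (k j :: 'a::real_vector))"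
  using assms by (intro sum.mono_neutral_right) (auto simp: rk_explicit_def)

lemma rk_stages_explicit_iff:
  assumes "rk_explicit s A"
  shows "rk_stages s A h X x k \<longleftrightarrow> (\<forall>i\<in>{1..s}. k i = rk_stage A h X x i)"
proof
  assume k: "rk_stages s A h X x k"
  have "i \<in> {1..s} \<Longrightarrow> k i = rk_stage A h X x i" for i
  proof (induction i rule: less_induct)
    case (less i)
    have "k i = X (x + h *\<^sub>R (\<Sum>j=1..<i. A i j *\<^sub>R k j))"
      using k less.prems rk_explicit_sum[OF assms less.prems, of k] by (simp add: rk_stages_def)
    also have "(\<Sum>j=1..<i. A i j *\<^sub>R k j) = (\<Sum>j=1..<i. A i j *\<^sub>R rk_stage A h X x j)"
      using less by (intro sum.cong) auto
    finally show ?case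
      by (subst rk_stage.simps)
  qed
  then show "\<forall>i\<in>{1..s}. k i = rk_stage A h X x i" by blast
next
  assume k: "\<forall>i\<in>{1..s}. k i = rk_stage A h X x i"
  show "rk_stages s A h X x k"
    unfolding rk_stages_def
  proof
    fix i assume i: "i \<in> {1..s}"
    have "(\<Sum>j=1..<i. A i j *\<^sub>R rk_stage A h X x j) = (\<Sum>j=1..<i. A i j *\<^sub>R k j)"
      using k i by (intro sum.cong) auto
    then show "k i = X (x + h *\<^sub>R (\<Sum>j=1..s. A i j *\<^sub>R k j))"
      using k i rk_stage.simps[of A h X x i] by (simp only: rk_explicit_sum[OF assms i])
  qed
qed

lemma runge_kutta_explicit:
  assumes "rk_explicit s A"
  shows "runge_kutta s A b h X x = x + h *\<^sub>R (\<Sum>i=1..s. b i *\<^sub>R rk_stage A h X x i)"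
  unfolding runge_kutta_def
proof (rule the_equality)
  show "\<exists>k. rk_stages s A h X x k \<and>
      x + h *\<^sub>R (\<Sum>i=1..s. b i *\<^sub>R rk_stage A h X x i) = x + h *\<^sub>R (\<Sum>i=1..s. b i *\<^sub>R k i)"
    by (rule exI[of _ "rk_stage A h X x"]) (simp add: rk_stages_explicit_iff[OF assms])
qed (auto simp: rk_stages_explicit_iff[OF assms])

end

theory Submission
  imports Defs
begin

text \<open>
  The stages \<open>k\<^sub>i\<close> are values of the vector field, so they transform under the linear part \<open>L\<close>
  alone: \<open>L k\<^sub>X\<^sub>,\<^sub>i(x) = k\<^sub>Y\<^sub>,\<^sub>i(L x + p)\<close>. The arguments of the vector field and the final step are
  points, of the form base point plus a linear combination of stages, so they transform under
  the affine map \<open>z \<mapsto> L z + p\<close>; the translation acts only on the base point. Hence the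
  intertwining relation passes from the earlier stages to the next argument, through the
  hypothesis on \<open>X\<close> and \<open>Y\<close> to the next stage (lemma \<open>affine_related_rk_stage\<close>), and finally
  to the step itself.
\<close>

lemma affine_image_rk_update:
  fixes L :: "'a::real_vector \<Rightarrow> 'b::real_vector"
  assumes "linear L"
  shows "L (x + h *\<^sub>R (\<Sum>j\<in>J. c j *\<^sub>R k j)) + p = (L x + p) + h *\<^sub>R (\<Sum>j\<in>J. c j *\<^sub>R L (k j))"
  by (simp add: linear_add[OF assms] linear_scale[OF assms] linear_sum[OF assms])

text \<open>
  Strong induction on the stage index works because the recursion for stage \<open>i\<close> involves only
  stages below \<open>i\<close>.
\<close>

lemma affine_related_rk_stage:
  fixes L :: "'a::real_vector \<Rightarrow> 'b::real_vector"
  assumes "linear L" and related: "\<And>x. L (X x) = Y (L x + p)"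
  shows "L (rk_stage A h X x i) = rk_stage A h Y (L x + p) i"
proof (induction i rule: less_induct)
  case (less i)
  have "L (rk_stage A h X x i) = Y (L (x + h *\<^sub>R (\<Sum>j=1..<i. A i j *\<^sub>R rk_stage A h X x j)) + p)"
    by (simp only: rk_stage.simps[of A h X x i] related)
  also have "\<dots> = Y ((L x + p) + h *\<^sub>R (\<Sum>j=1..<i. A i j *\<^sub>R L (rk_stage A h X x j)))"
    by (simp only: affine_image_rk_update[OF \<open>linear L\<close>])
  also have "(\<Sum>j=1..<i. A i j *\<^sub>R L (rk_stage A h X x j)) =
      (\<Sum>j=1..<i. A i j *\<^sub>R rk_stage A h Y (L x + p) j)"
    using less.IH by (intro sum.cong) auto
  finally show ?case
    by (simp only: rk_stage.simps[of A h Y "L x + p" i])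
qed

theorem theorem3p1:
  fixes X :: "real ^ 'n \<Rightarrow> real ^ 'n"
    and Y :: "real ^ 'm \<Rightarrow> real ^ 'm"
    and L :: "real ^ 'n \<Rightarrow> real ^ 'm"
    and p :: "real ^ 'm"
  assumes "linear L"
    and "\<forall>x. L (X x) = Y (L x + p)"
  shows "\<forall>(s::nat) (h::real) (b::nat \<Rightarrow> real) (A::nat \<Rightarrow> nat \<Rightarrow> real).
           rk_explicit s A \<longrightarrow>
           (\<forall>x. L (runge_kutta s A b h X x) + p = runge_kutta s A b h Y (L x + p))"
proof (intro allI impI)
  fix s h b A x
  assume explicit: "rk_explicit s A"
  have stages: "L (rk_stage A h X x i) = rk_stage A h Y (L x + p) i" for i
    using assms by (intro affine_related_rk_stage) auto
  show "L (runge_kutta s A b h X x) + p = runge_kutta s A b h Y (L x + p)"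
    by (simp only: runge_kutta_explicit[OF explicit] affine_image_rk_update[OF \<open>linear L\<close>] stages)
qed

end
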